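(* Let $M = \{(x,y,z) \in \mathbb{C}^3 : x y = z^2\}$ and consider on $M$ the vector fields $$\Theta = 2 z \frac{\partial}{\partial x} + y \frac{\partial}{\partial z}, \qquad \Xi = 2 z \frac{\partial}{\partial y} + x \frac{\partial}{\partial z}, \qquad H = 2 y \frac{\partial}{\partial y} - 2 x \frac{\partial}{\partial x}.$$ The group of holomorphic automorphisms of $M$ generated by the flows of $\Xi$, $\Theta$, $z\,\Xi$ and $z H$ acts infinitely transitively on the regular locus of $M$.
   Context: The vector fields $\Xi$, $\Theta$, $z\,\Xi$, $zH$ are tangent to $M$ and complete, i.e. their flows exist for all complex times $t \in \mathbb{C}$; the group in question is generated by all time-$t$ flow maps. The regular locus of $M$ is $M \setminus \{(0,0,0)\}$. A group $G$ acts infinitely transitively on a set $Y$ if for every $m \in \mathbb{N}$ it acts $m$-transitively, i.e. for any pairwise distinct $p_1,\dots,p_m \in Y$ and any pairwise distinct $q_1,\dots,q_m \in Y$ there is $F \in G$ with $F(p_j) = q_j$ for $j=1,\dots,m$. *)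

theory Defs
  imports "HOL-Analysis.Analysis" "HOL-Algebra.Group_Action" "HOL-Algebra.Generated_Groups"
begin

text \<open>Holomorphic maps in several variables: the Frechet derivative exists and is
  complex linear, i.e. it is given by a complex matrix.\<close>

definition holomorphic_vec_on :: "(complex ^ 'n \<Rightarrow> complex ^ 'm) \<Rightarrow> (complex ^ 'n) set \<Rightarrow> bool" where
  "holomorphic_vec_on g U \<longleftrightarrow>
     open U \<and> (\<forall>p\<in>U. \<exists>A :: complex ^ 'n ^ 'm. (g has_derivative (\<lambda>h. A *v h)) (at p))"

text \<open>On a (possibly singular) analytic subset, a map is holomorphic if it is locally the
  restriction of a holomorphic map defined on an open set of the ambient space.\<close>

definition holomorphic_map_on :: "(complex ^ 'n) set \<Rightarrow> (complex ^ 'n \<Rightarrow> complex ^ 'm) \<Rightarrow> bool" where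
  "holomorphic_map_on X f \<longleftrightarrow>
     (\<forall>p\<in>X. \<exists>U g. p \<in> U \<and> holomorphic_vec_on g U \<and> (\<forall>q\<in>U \<inter> X. f q = g q))"

text \<open>Self-maps of a set \<open>X\<close> are represented as in the library group \<open>BijGroup X\<close>, by functions
  that are \<open>undefined\<close> outside \<open>X\<close>.\<close>

definition hol_aut_group :: "(complex ^ 'n) set \<Rightarrow> (complex ^ 'n \<Rightarrow> complex ^ 'n) monoid" where
  "hol_aut_group X = BijGroup X \<lparr>carrier :=
     {f \<in> Bij X. holomorphic_map_on X f \<and> holomorphic_map_on X (inv_into X f)}\<rparr>"

text \<open>\<open>\<phi>\<close> is a flow, for all complex times, of the vector field \<open>V\<close> on \<open>X\<close>. The derivative in
  the time variable is a complex derivative, since \<open>*s\<close> is complex scalar multiplication.\<close>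

definition complete_flow_on ::
  "(complex ^ 'n) set \<Rightarrow> (complex ^ 'n \<Rightarrow> complex ^ 'n) \<Rightarrow> (complex \<Rightarrow> complex ^ 'n \<Rightarrow> complex ^ 'n) \<Rightarrow> bool" where
  "complete_flow_on X V \<phi> \<longleftrightarrow>
     (\<forall>p\<in>X. \<phi> 0 p = p \<and>
        (\<forall>t. \<phi> t p \<in> X \<and> ((\<lambda>s. \<phi> s p) has_derivative (\<lambda>h. h *s V (\<phi> t p))) (at t)))"

definition flow_maps :: "(complex ^ 'n) set \<Rightarrow> (complex ^ 'n \<Rightarrow> complex ^ 'n) \<Rightarrow> (complex ^ 'n \<Rightarrow> complex ^ 'n) set" where
  "flow_maps X V = {restrict (\<phi> t) X |\<phi> t. complete_flow_on X V \<phi>}"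

definition flow_generated :: "(complex ^ 'n) set \<Rightarrow> (complex ^ 'n \<Rightarrow> complex ^ 'n) set \<Rightarrow> (complex ^ 'n \<Rightarrow> complex ^ 'n) set" where
  "flow_generated X \<V> = generate (hol_aut_group X) (\<Union>V\<in>\<V>. flow_maps X V)"

definition m_transitive_on :: "('g \<Rightarrow> 'b \<Rightarrow> 'b) \<Rightarrow> 'g set \<Rightarrow> 'b set \<Rightarrow> nat \<Rightarrow> bool" where
  "m_transitive_on act G Y m \<longleftrightarrow>
     (\<forall>p q :: nat \<Rightarrow> 'b.
        p ` {..<m} \<subseteq> Y \<and> inj_on p {..<m} \<and> q ` {..<m} \<subseteq> Y \<and> inj_on q {..<m} \<longrightarrow>
        (\<exists>g\<in>G. \<forall>j<m. act g (p j) = q j))"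

definition infinitely_transitive_action :: "('g, 'r) monoid_scheme \<Rightarrow> 'b set \<Rightarrow> ('g \<Rightarrow> 'b \<Rightarrow> 'b) \<Rightarrow> bool" where
  "infinitely_transitive_action G Y act \<longleftrightarrow>
     group_action G Y act \<and> (\<forall>m. m_transitive_on act (carrier G) Y m)"

text \<open>The surface \<open>x y = z\<^sup>2\<close>, with coordinates \<open>x = p $ 1\<close>, \<open>y = p $ 2\<close>, \<open>z = p $ 3\<close>. Vector
  fields on it are given by their coefficient vectors with respect to
  \<open>\<partial>/\<partial>x\<close>, \<open>\<partial>/\<partial>y\<close>, \<open>\<partial>/\<partial>z\<close>.\<close>

definition quad_cone :: "(complex ^ 3) set" where
  "quad_cone = {p. p $ 1 * p $ 2 = (p $ 3)\<^sup>2}"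

definition quad_cone_reg :: "(complex ^ 3) set" where
  "quad_cone_reg = quad_cone - {0}"

definition Theta :: "complex ^ 3 \<Rightarrow> complex ^ 3" where
  "Theta p = vector [2 * p $ 3, 0, p $ 2]"

definition Xi :: "complex ^ 3 \<Rightarrow> complex ^ 3" where
  "Xi p = vector [0, 2 * p $ 3, p $ 1]"

definition Hfield :: "complex ^ 3 \<Rightarrow> complex ^ 3" where
  "Hfield p = vector [- (2 * p $ 1), 2 * p $ 2, 0]"

definition z_times :: "(complex ^ 3 \<Rightarrow> complex ^ 3) \<Rightarrow> complex ^ 3 \<Rightarrow> complex ^ 3" where
  "z_times V p = p $ 3 *s V p"

end

theory Submission
  imports Defs
begin

text \<open>The cone is the quotient of the plane by \<open>\<plusminus>1\<close>, through
  \<open>x = u\<^sup>2\<close>, \<open>y = v\<^sup>2\<close>, \<open>z = u v\<close>. In these coordinates the flow of \<open>\<Xi>\<close> at time \<open>s\<close> is the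
  linear shear \<open>v \<mapsto> v + s u\<close>, the flow of \<open>\<Theta>\<close> is \<open>u \<mapsto> u + s v\<close>, and the flow of \<open>z \<Xi>\<close> at time \<open>t\<close>
  is the scaling \<open>v \<mapsto> e\<^bsup>t x\<^esup> v\<close> with \<open>x = u\<^sup>2\<close>. All three fix either \<open>u\<close> or \<open>v\<close>.

  The idea is to conjugate: scaling by \<open>e\<^bsup>t x\<^esup>\<close>, shearing by \<open>s\<close> and scaling back is the shear
  \<open>v \<mapsto> v + s e\<^bsup>- t x\<^esup> u\<close> (\<open>z_Xi_flow_conjugates_shear\<close>). Shears add up under composition, so the
  group contains \<open>v \<mapsto> v + f(x) u\<close> for every finite exponential sum \<open>f\<close>, and such sums take
  prescribed values at finitely many points (\<open>interpolating_shear\<close>). Hence, as soon as finitely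
  many points of the cone have pairwise distinct non-zero \<open>x\<close>-coordinates, one group element
  keeps these coordinates and moves the \<open>z\<close>-coordinates to arbitrary values (\<open>prescribe_z\<close>).

  This is used twice to bring an arbitrary configuration \<open>p\<^sub>0, p\<^sub>1, \<dots>\<close> of distinct regular points to
  the configuration \<open>(1,1,1), (2,2,2), \<dots>\<close>, which depends only on the number of points
  (\<open>configuration_normal_form\<close>). A generic time of the flow of \<open>\<Theta>\<close> makes the \<open>x\<close>-coordinates
  distinct and non-zero; an interpolated shear makes \<open>z\<^sub>j\<close> a square root of \<open>x\<^sub>j (j + 1)\<close>, so that
  \<open>y\<^sub>j = j + 1\<close>; the linear map \<open>(u, v) \<mapsto> (v, - u)\<close>, a product of three shears, exchanges \<open>x\<close> and
  \<open>y\<close>; and a second interpolated shear makes \<open>z\<^sub>j = j + 1\<close>, hence all coordinates \<open>j + 1\<close>. Any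
  two configurations are then related through this normal form.

  That the generators are holomorphic automorphisms fixing the singular point rests on the
  uniqueness of flows: each of the four flows is determined by scalar linear differential
  equations, solved one coordinate after the other, so that every flow in the sense of the
  definition is the explicit one.\<close>

section \<open>Holomorphic automorphism groups\<close>

lemma vec_has_derivativeI:
  fixes f :: "'a::real_normed_vector \<Rightarrow> ('b::euclidean_space) ^ 'n"
  assumes "\<And>i. ((\<lambda>x. f x $ i) has_derivative (\<lambda>h. D h $ i)) (at p within S)"
  shows "(f has_derivative D) (at p within S)"
  by (subst has_derivative_componentwise_within)
    (auto simp: Basis_vec_def inner_axis intro!: assms has_derivative_inner_left)

text \<open>A real derivative that commutes with complex scalars is given by a complex matrix, so
  holomorphy can be checked without writing Jacobians.\<close>

lemma holomorphic_vec_onI: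
  fixes g :: "complex ^ 'n \<Rightarrow> complex ^ 'm"
  assumes "open U"
    and deriv: "\<And>p. p \<in> U \<Longrightarrow> \<exists>D. (g has_derivative D) (at p) \<and> (\<forall>c h. D (c *s h) = c *s D h)"
  shows "holomorphic_vec_on g U"
  unfolding holomorphic_vec_on_def
proof (intro conjI ballI)
  fix p assume "p \<in> U"
  with deriv obtain D where D: "(g has_derivative D) (at p)" "\<And>c h. D (c *s h) = c *s D h"
    by blast
  have "Vector_Spaces.linear (*s) (*s) D"
    using has_derivative_linear[OF D(1)] D(2)
    by (simp add: Vector_Spaces.linear_iff linear_add vec.vector_space_axioms)
  then have "D = (\<lambda>h. matrix D *v h)"
    by (auto simp: matrix_works)
  with D(1) show "\<exists>A :: complex ^ 'n ^ 'm. (g has_derivative (\<lambda>h. A *v h)) (at p)"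
    by metis
qed fact

definition entire_fun :: "(complex ^ 'n \<Rightarrow> complex) \<Rightarrow> bool" where
  "entire_fun a \<longleftrightarrow> (\<forall>p. \<exists>D. (a has_derivative D) (at p) \<and> (\<forall>c h. D (c *s h) = c * D h))"

lemma entire_fun_const: "entire_fun (\<lambda>p. k)"
  unfolding entire_fun_def by (intro allI exI[of _ "\<lambda>_. 0"]) simp

lemma entire_fun_nth: "entire_fun (\<lambda>p. p $ i)"
  unfolding entire_fun_def
  by (intro allI exI[of _ "\<lambda>h. h $ i"])
    (simp add: bounded_linear_imp_has_derivative bounded_linear_vec_nth)

lemma entire_fun_add:
  assumes "entire_fun a" "entire_fun b"
  shows "entire_fun (\<lambda>p. a p + b p)"
  unfolding entire_fun_def
proof
  fix p
  obtain A B where "(a has_derivative A) (at p)" "\<forall>c h. A (c *s h) = c * A h"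
    "(b has_derivative B) (at p)" "\<forall>c h. B (c *s h) = c * B h"
    using assms unfolding entire_fun_def by blast
  then show "\<exists>D. ((\<lambda>p. a p + b p) has_derivative D) (at p) \<and> (\<forall>c h. D (c *s h) = c * D h)"
    by (intro exI[of _ "\<lambda>h. A h + B h"]) (simp add: has_derivative_add distrib_left)
qed

lemma entire_fun_mult:
  assumes "entire_fun a" "entire_fun b"
  shows "entire_fun (\<lambda>p. a p * b p)"
  unfolding entire_fun_def
proof
  fix p
  obtain A B where "(a has_derivative A) (at p)" "\<forall>c h. A (c *s h) = c * A h"
    "(b has_derivative B) (at p)" "\<forall>c h. B (c *s h) = c * B h"
    using assms unfolding entire_fun_def by blast
  then show "\<exists>D. ((\<lambda>p. a p * b p) has_derivative D) (at p) \<and> (\<forall>c h. D (c *s h) = c * D h)"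
    by (intro exI[of _ "\<lambda>h. a p * B h + A h * b p"] conjI has_derivative_mult)
      (simp_all add: algebra_simps)
qed

lemma entire_fun_exp:
  assumes "entire_fun a"
  shows "entire_fun (\<lambda>p. exp (a p))"
  unfolding entire_fun_def
proof
  fix p
  obtain A where "(a has_derivative A) (at p)" "\<forall>c h. A (c *s h) = c * A h"
    using assms unfolding entire_fun_def by blast
  then show "\<exists>D. ((\<lambda>p. exp (a p)) has_derivative D) (at p) \<and> (\<forall>c h. D (c *s h) = c * D h)"
    using has_derivative_compose[OF _ DERIV_exp[unfolded has_field_derivative_def], of a A]
    by (intro exI[of _ "\<lambda>h. exp (a p) * A h"]) simp
qed

lemmas entire_fun_intros =
  entire_fun_const entire_fun_nth entire_fun_add entire_fun_mult entire_fun_exp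

lemma holomorphic_map_on_components:
  fixes g :: "complex ^ 'n \<Rightarrow> complex ^ 'm"
  assumes "\<And>i. entire_fun (\<lambda>p. g p $ i)"
  shows "holomorphic_map_on X g"
proof -
  have "holomorphic_vec_on g UNIV"
  proof (rule holomorphic_vec_onI)
    fix p
    have "\<forall>i. \<exists>D. ((\<lambda>p. g p $ i) has_derivative D) (at p) \<and> (\<forall>c h. D (c *s h) = c * D h)"
      using assms unfolding entire_fun_def by blast
    from choice[OF this] obtain D where D: "\<And>i. ((\<lambda>p. g p $ i) has_derivative D i) (at p)"
      "\<And>i c h. D i (c *s h) = c * D i h"
      by blast
    have "(g has_derivative (\<lambda>h. \<chi> i. D i h)) (at p)"
      by (rule vec_has_derivativeI) (simp add: D(1))
    then show "\<exists>D. (g has_derivative D) (at p) \<and> (\<forall>c h. D (c *s h) = c *s D h)"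
      by (intro exI[of _ "\<lambda>h. \<chi> i. D i h"]) (simp add: vec_eq_iff D(2))
  qed simp
  then show ?thesis
    unfolding holomorphic_map_on_def by blast
qed

lemma holomorphic_map_on_id: "holomorphic_map_on X (\<lambda>p. p)"
  by (rule holomorphic_map_on_components) (rule entire_fun_nth)

lemma holomorphic_map_on_cong:
  assumes "holomorphic_map_on X f" "\<And>p. p \<in> X \<Longrightarrow> f p = g p"
  shows "holomorphic_map_on X g"
  using assms unfolding holomorphic_map_on_def by (metis Int_iff)

lemma holomorphic_map_on_compose:
  assumes f: "holomorphic_map_on X f" and g: "holomorphic_map_on Y g" and fX: "f ` X \<subseteq> Y"
  shows "holomorphic_map_on X (\<lambda>p. g (f p))"
  unfolding holomorphic_map_on_def
proof
  fix p assume p: "p \<in> X"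
  obtain U f' where U: "p \<in> U" "holomorphic_vec_on f' U" "\<And>q. q \<in> U \<inter> X \<Longrightarrow> f q = f' q"
    using f p unfolding holomorphic_map_on_def by metis
  obtain V g' where V: "f p \<in> V" "holomorphic_vec_on g' V" "\<And>q. q \<in> V \<inter> Y \<Longrightarrow> g q = g' q"
    using g p fX unfolding holomorphic_map_on_def by (metis image_subset_iff)
  have opn: "open U" "open V"
    using U V by (auto simp: holomorphic_vec_on_def)
  have cont: "continuous_on U f'"
    using U(2) unfolding holomorphic_vec_on_def
    by (metis continuous_at_imp_continuous_on has_derivative_continuous)
  have "holomorphic_vec_on (\<lambda>q. g' (f' q)) (U \<inter> f' -` V)"
  proof (rule holomorphic_vec_onI)
    show "open (U \<inter> f' -` V)"
      by (rule continuous_open_preimage[OF cont opn])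
    fix q assume q: "q \<in> U \<inter> f' -` V"
    obtain A where A: "(f' has_derivative (\<lambda>h. A *v h)) (at q)"
      using U(2) q by (auto simp: holomorphic_vec_on_def)
    obtain B where B: "(g' has_derivative (\<lambda>h. B *v h)) (at (f' q))"
      using V(2) q by (auto simp: holomorphic_vec_on_def)
    show "\<exists>D. ((\<lambda>q. g' (f' q)) has_derivative D) (at q) \<and> (\<forall>c h. D (c *s h) = c *s D h)"
      using has_derivative_compose[OF A B] by (metis vector_scalar_commute)
  qed
  moreover have "p \<in> U \<inter> f' -` V"
    using U V p by auto
  moreover have "g (f q) = g' (f' q)" if "q \<in> U \<inter> f' -` V \<inter> X" for q
    using that U(3)[of q] V(3)[of "f q"] fX by auto
  ultimately show "\<exists>U h. p \<in> U \<and> holomorphic_vec_on h U \<and> (\<forall>q\<in>U \<inter> X. g (f q) = h q)"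
    by (intro exI[of _ "U \<inter> f' -` V"] exI[of _ "\<lambda>q. g' (f' q)"] conjI ballI)
qed

text \<open>The carrier asks for a holomorphic inverse, which makes closure under inversion immediate;
  the work lies in identifying \<open>inv_into\<close> of an inverse and of a composite on \<open>X\<close>.\<close>

lemma subgroup_hol_aut: "subgroup (carrier (hol_aut_group X)) (BijGroup X)"
proof (rule group.subgroupI[OF group_BijGroup])
  let ?K = "carrier (hol_aut_group X)"
  have K: "f \<in> ?K \<longleftrightarrow> f \<in> Bij X \<and> holomorphic_map_on X f \<and> holomorphic_map_on X (inv_into X f)"
    for f by (simp add: hol_aut_group_def)
  show "?K \<subseteq> carrier (BijGroup X)"
    by (auto simp: K BijGroup_def)
  have "(\<lambda>x\<in>X. x) \<in> ?K"
    unfolding K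
  proof (intro conjI)
    show "(\<lambda>x\<in>X. x) \<in> Bij X" by (rule id_Bij)
    show "holomorphic_map_on X (\<lambda>x\<in>X. x)"
      by (rule holomorphic_map_on_cong[OF holomorphic_map_on_id]) simp
    show "holomorphic_map_on X (inv_into X (\<lambda>x\<in>X. x))"
      by (rule holomorphic_map_on_cong[OF holomorphic_map_on_id])
        (metis inv_into_f_f inj_on_id2 inj_on_restrict_eq restrict_apply')
  qed
  then show "?K \<noteq> {}" by blast
  show "inv\<^bsub>BijGroup X\<^esub> f \<in> ?K" if f: "f \<in> ?K" for f
  proof -
    have f': "f \<in> Bij X" "holomorphic_map_on X f" "holomorphic_map_on X (inv_into X f)"
      using f by (auto simp: K)
    have bij: "bij_betw f X X" using f' by (simp add: Bij_def)
    have "inv_into X (restrict (inv_into X f) X) p = f p" if "p \<in> X" for p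
    proof (rule inv_into_f_eq)
      show "inj_on (restrict (inv_into X f) X) X"
        using restrict_inv_into_Bij[OF f'(1)] by (simp add: Bij_def bij_betw_def)
      show "f p \<in> X"
        using f'(1) that by (auto dest: Bij_imp_funcset)
      then show "restrict (inv_into X f) X (f p) = p"
        using bij that by (simp add: bij_betw_inv_into_left)
    qed
    then have "holomorphic_map_on X (inv_into X (restrict (inv_into X f) X))"
      by (intro holomorphic_map_on_cong[OF f'(2)]) simp
    moreover have "holomorphic_map_on X (restrict (inv_into X f) X)"
      by (rule holomorphic_map_on_cong[OF f'(3)]) simp
    ultimately show ?thesis
      using restrict_inv_into_Bij[OF f'(1)] by (simp add: inv_BijGroup f'(1) K)
  qed
  show "f \<otimes>\<^bsub>BijGroup X\<^esub> g \<in> ?K" if f: "f \<in> ?K" and g: "g \<in> ?K" for f g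
  proof -
    have f': "f \<in> Bij X" "holomorphic_map_on X f" "holomorphic_map_on X (inv_into X f)"
      and g': "g \<in> Bij X" "holomorphic_map_on X g" "holomorphic_map_on X (inv_into X g)"
      using f g by (auto simp: K)
    have bij: "bij_betw f X X" "bij_betw g X X" using f' g' by (auto simp: Bij_def)
    have im: "g ` X \<subseteq> X" "inv_into X f ` X \<subseteq> X"
      using bij bij_betw_inv_into[of f X X] by (auto simp: bij_betw_def)
    have c: "compose X f g \<in> Bij X"
      by (rule compose_Bij) fact+
    have inv: "inv_into X (compose X f g) p = inv_into X g (inv_into X f p)" if "p \<in> X" for p
    proof (rule inv_into_f_eq)
      show "inj_on (compose X f g) X" using c by (simp add: Bij_def bij_betw_def)
      show "inv_into X g (inv_into X f p) \<in> X"
        using that f'(1) g'(1) by (simp add: Bij_inv_into_mem)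
      then show "compose X f g (inv_into X g (inv_into X f p)) = p"
        using that bij f'(1) by (simp add: compose_def Bij_inv_into_mem bij_betw_inv_into_right)
    qed
    have "holomorphic_map_on X (compose X f g)"
      by (rule holomorphic_map_on_cong[OF holomorphic_map_on_compose[OF g'(2) f'(2) im(1)]])
        (simp add: compose_def)
    moreover have "holomorphic_map_on X (inv_into X (compose X f g))"
      by (rule holomorphic_map_on_cong[OF holomorphic_map_on_compose[OF f'(3) g'(3) im(2)]])
        (simp add: inv)
    ultimately show ?thesis
      using c f' g' by (simp add: BijGroup_def K)
  qed
qed

lemma hol_aut_group_eq: "hol_aut_group X = BijGroup X \<lparr>carrier := carrier (hol_aut_group X)\<rparr>"
  by (simp add: hol_aut_group_def)

lemma group_hol_aut_group: "group (hol_aut_group X)"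
  by (subst hol_aut_group_eq)
    (rule subgroup.subgroup_is_group[OF subgroup_hol_aut group_BijGroup])

lemma hol_aut_Bij: "f \<in> carrier (hol_aut_group X) \<Longrightarrow> f \<in> Bij X"
  by (simp add: hol_aut_group_def)

lemma hol_aut_mult:
  assumes "f \<in> carrier (hol_aut_group X)" "g \<in> carrier (hol_aut_group X)"
  shows "f \<otimes>\<^bsub>hol_aut_group X\<^esub> g = compose X f g"
  using assms by (simp add: hol_aut_group_def BijGroup_def)

lemma hol_aut_one: "\<one>\<^bsub>hol_aut_group X\<^esub> = (\<lambda>p\<in>X. p)"
  by (simp add: hol_aut_group_def BijGroup_def)

lemma hol_aut_inv_apply:
  assumes "f \<in> carrier (hol_aut_group X)" "p \<in> X"
  shows "(inv\<^bsub>hol_aut_group X\<^esub> f) (f p) = p"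
proof -
  interpret group "hol_aut_group X" by (rule group_hol_aut_group)
  have "compose X (inv\<^bsub>hol_aut_group X\<^esub> f) f = (\<lambda>p\<in>X. p)"
    using l_inv[OF assms(1)] assms(1) by (simp add: hol_aut_mult hol_aut_one)
  then show ?thesis
    using assms(2) by (metis compose_eq restrict_apply')
qed

text \<open>To act on the complement of a point it is enough to fix that point.\<close>

lemma group_action_minus_fixed_point:
  assumes H: "subgroup H (hol_aut_group X)"
    and a: "a \<in> X" "\<And>f. f \<in> H \<Longrightarrow> f a = a"
  shows "group_action (hol_aut_group X \<lparr>carrier := H\<rparr>) (X - {a}) (\<lambda>f. restrict f (X - {a}))"
proof -
  let ?Y = "X - {a}"
  have carr: "f \<in> carrier (hol_aut_group X)" if "f \<in> H" for f
    using subgroup.subset[OF H] that by blast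
  have bij: "bij_betw f ?Y ?Y" if "f \<in> H" for f
  proof -
    have "bij_betw f X X" using hol_aut_Bij[OF carr[OF that]] by (simp add: Bij_def)
    then show ?thesis
      using a(1) a(2)[OF that] by (intro bij_betw_DiffI) auto
  qed
  have Bij: "restrict f ?Y \<in> Bij ?Y" if "f \<in> H" for f
    using bij[OF that] by (simp add: Bij_def)
  have "restrict (f \<otimes>\<^bsub>hol_aut_group X\<^esub> g) ?Y = restrict f ?Y \<otimes>\<^bsub>BijGroup ?Y\<^esub> restrict g ?Y"
    if "f \<in> H" "g \<in> H" for f g
  proof
    fix p
    have "g p \<in> ?Y" if "p \<in> ?Y"
      using bij_betwE[OF bij[OF \<open>g \<in> H\<close>]] that by blast
    then show "restrict (f \<otimes>\<^bsub>hol_aut_group X\<^esub> g) ?Y p = (restrict f ?Y \<otimes>\<^bsub>BijGroup ?Y\<^esub> restrict g ?Y) p"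
      using Bij[OF that(1)] Bij[OF that(2)]
      by (simp add: hol_aut_mult carr that BijGroup_def compose_def)
  qed
  moreover have "restrict f ?Y \<in> carrier (BijGroup ?Y)" if "f \<in> H" for f
    using Bij[OF that] by (simp add: BijGroup_def)
  ultimately show ?thesis
    by (simp add: group_action_def group_hom_def group_hom_axioms_def hom_def group_BijGroup
        subgroup.subgroup_is_group[OF H group_hol_aut_group])
qed

section \<open>Flows\<close>

text \<open>Coordinatewise, a flow solves scalar complex differential equations, to which uniqueness
  for functions of one complex variable applies.\<close>

lemma complete_flow_on_iff:
  "complete_flow_on X V \<phi> \<longleftrightarrow> (\<forall>p\<in>X. \<phi> 0 p = p \<and> (\<forall>t. \<phi> t p \<in> X \<and>
      (\<forall>i. ((\<lambda>s. \<phi> s p $ i) has_field_derivative V (\<phi> t p) $ i) (at t))))"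
proof -
  have "((\<lambda>s. \<phi> s p) has_derivative (\<lambda>h. h *s v)) (at t) \<longleftrightarrow>
      (\<forall>i. ((\<lambda>s. \<phi> s p $ i) has_field_derivative v $ i) (at t))" for p t v
  proof
    assume L: "((\<lambda>s. \<phi> s p) has_derivative (\<lambda>h. h *s v)) (at t)"
    show "\<forall>i. ((\<lambda>s. \<phi> s p $ i) has_field_derivative v $ i) (at t)"
      using bounded_linear.has_derivative[OF bounded_linear_vec_nth L]
      by (auto simp: has_field_derivative_def mult_commute_abs)
  next
    assume "\<forall>i. ((\<lambda>s. \<phi> s p $ i) has_field_derivative v $ i) (at t)"
    then show "((\<lambda>s. \<phi> s p) has_derivative (\<lambda>h. h *s v)) (at t)"
      by (intro vec_has_derivativeI) (simp add: has_field_derivative_def mult_commute_abs)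
  qed
  then show ?thesis
    by (simp add: complete_flow_on_def)
qed

lemma same_derivative_imp_eq:
  fixes f g :: "complex \<Rightarrow> complex"
  assumes "\<And>t. (f has_field_derivative d t) (at t)" "\<And>t. (g has_field_derivative d t) (at t)" "f 0 = g 0"
  shows "f t = g t"
proof -
  have "\<exists>c. \<forall>t\<in>UNIV. f t - g t = c"
    by (rule has_field_derivative_zero_constant)
      (auto intro!: derivative_eq_intros assms(1,2))
  with assms(3) show ?thesis
    by (metis UNIV_I eq_iff_diff_eq_0)
qed

text \<open>The product \<open>f(t) e\<^bsup>- c t\<^esup>\<close> has zero derivative.\<close>

lemma derivative_multiple_imp_exp:
  fixes f :: "complex \<Rightarrow> complex"
  assumes "\<And>t. (f has_field_derivative c * f t) (at t)"
  shows "f t = f 0 * exp (c * t)"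
proof -
  have "f t * exp (- c * t) = f 0"
    by (rule same_derivative_imp_eq[where d = "\<lambda>_. 0"])
      (auto intro!: derivative_eq_intros assms)
  then show ?thesis
    by (metis (no_types) exp_minus_inverse mult.assoc mult.commute mult.right_neutral mult_minus_left)
qed


text \<open>The set of flow maps is defined by ranging over all flows. Uniqueness collapses it to
  one explicit one-parameter family.\<close>

lemma flow_maps_eqI:
  assumes "complete_flow_on X V \<Psi>"
    and "\<And>\<phi> t p. complete_flow_on X V \<phi> \<Longrightarrow> p \<in> X \<Longrightarrow> \<phi> t p = \<Psi> t p"
  shows "flow_maps X V = range (\<lambda>t. restrict (\<Psi> t) X)"
proof -
  have "restrict (\<phi> t) X = restrict (\<Psi> t) X" if "complete_flow_on X V \<phi>" for \<phi> t
    using assms(2)[OF that] by (intro restrict_ext)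
  with assms(1) show ?thesis
    unfolding flow_maps_def by fast
qed

lemma one_parameter_hol_aut:
  assumes maps: "\<And>t p. p \<in> X \<Longrightarrow> \<Psi> t p \<in> X"
    and inv: "\<And>t p. p \<in> X \<Longrightarrow> \<Psi> (- t) (\<Psi> t p) = p"
    and hol: "\<And>t. holomorphic_map_on X (\<Psi> t)"
  shows "restrict (\<Psi> (t::'t::group_add)) X \<in> carrier (hol_aut_group X)"
proof -
  have inv': "\<Psi> t (\<Psi> (- t) p) = p" if "p \<in> X" for p
    using inv[OF that, of "- t"] by simp
  have bij: "bij_betw (restrict (\<Psi> t) X) X X"
    by (rule bij_betw_byWitness[where f' = "\<Psi> (- t)"]) (auto simp: maps inv inv')
  have "inv_into X (restrict (\<Psi> t) X) p = \<Psi> (- t) p" if "p \<in> X" for p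
    using bij that by (intro inv_into_f_eq) (auto simp: bij_betw_def maps inv')
  then have "holomorphic_map_on X (inv_into X (restrict (\<Psi> t) X))"
    by (intro holomorphic_map_on_cong[OF hol[of "- t"]]) simp
  moreover have "holomorphic_map_on X (restrict (\<Psi> t) X)"
    by (rule holomorphic_map_on_cong[OF hol[of t]]) simp
  ultimately show ?thesis
    using bij by (simp add: hol_aut_group_def Bij_def)
qed

section \<open>The flows on the cone\<close>

text \<open>The map \<open>(u, v) \<mapsto> (u, v + f(u\<^sup>2) u)\<close> of the plane, written in \<open>x = u\<^sup>2\<close>, \<open>y = v\<^sup>2\<close>, \<open>z = u v\<close>.
  For constant \<open>f\<close> it is a flow map of \<open>\<Xi>\<close>, and in general it is the time-one map of \<open>f(x) \<Xi>\<close>.\<close>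

definition shear :: "(complex \<Rightarrow> complex) \<Rightarrow> complex ^ 3 \<Rightarrow> complex ^ 3" where
  "shear f p = vector [p $ 1, p $ 2 + 2 * f (p $ 1) * p $ 3 + (f (p $ 1))\<^sup>2 * p $ 1, p $ 3 + f (p $ 1) * p $ 1]"

text \<open>On the plane: \<open>(u, v) \<mapsto> (u + t v, v)\<close>.\<close>

definition Theta_flow :: "complex \<Rightarrow> complex ^ 3 \<Rightarrow> complex ^ 3" where
  "Theta_flow t p = vector [p $ 1 + 2 * t * p $ 3 + t\<^sup>2 * p $ 2, p $ 2, p $ 3 + t * p $ 2]"

text \<open>On the plane: \<open>(u, v) \<mapsto> (u, v exp(t u\<^sup>2))\<close>. Off the cone this formula is not the flow of \<open>z \<Xi>\<close>.\<close>

definition z_Xi_flow :: "complex \<Rightarrow> complex ^ 3 \<Rightarrow> complex ^ 3" where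
  "z_Xi_flow t p = vector [p $ 1, p $ 2 * exp (2 * t * p $ 1), p $ 3 * exp (t * p $ 1)]"

text \<open>On the plane: \<open>(u, v) \<mapsto> (u exp(- t u v), v exp(t u v))\<close>.\<close>

definition z_H_flow :: "complex \<Rightarrow> complex ^ 3 \<Rightarrow> complex ^ 3" where
  "z_H_flow t p = vector [p $ 1 * exp (- (2 * t * p $ 3)), p $ 2 * exp (2 * t * p $ 3), p $ 3]"

lemmas explicit_flow_defs = shear_def Theta_flow_def z_Xi_flow_def z_H_flow_def

lemma field_components:
  "Xi p $ 1 = 0" "Xi p $ 2 = 2 * p $ 3" "Xi p $ 3 = p $ 1"
  "Theta p $ 1 = 2 * p $ 3" "Theta p $ 2 = 0" "Theta p $ 3 = p $ 2"
  "Hfield p $ 1 = - (2 * p $ 1)" "Hfield p $ 2 = 2 * p $ 2" "Hfield p $ 3 = 0"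
  "z_times V p $ i = p $ 3 * V p $ i"
  by (simp_all add: Xi_def Theta_def Hfield_def z_times_def)

lemma quad_cone_iff: "p \<in> quad_cone \<longleftrightarrow> p $ 1 * p $ 2 = (p $ 3)\<^sup>2"
  by (simp add: quad_cone_def)

lemma explicit_flows_in_quad_cone:
  assumes "p \<in> quad_cone"
  shows "shear f p \<in> quad_cone" "Theta_flow t p \<in> quad_cone"
    "z_Xi_flow t p \<in> quad_cone" "z_H_flow t p \<in> quad_cone"
proof -
  have eq: "p $ 1 * p $ 2 = (p $ 3)\<^sup>2"
    using assms by (simp add: quad_cone_iff)
  show "shear f p \<in> quad_cone" "Theta_flow t p \<in> quad_cone"
    unfolding quad_cone_iff shear_def Theta_flow_def vector_3 using eq by algebra+
  have "exp (2 * t * p $ 1) = (exp (t * p $ 1))\<^sup>2"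
    by (simp add: exp_double[symmetric] mult.assoc)
  then show "z_Xi_flow t p \<in> quad_cone"
    unfolding quad_cone_iff z_Xi_flow_def vector_3 using eq by algebra
  have "exp (- (2 * t * p $ 3)) * exp (2 * t * p $ 3) = 1"
    by (simp add: exp_minus)
  then show "z_H_flow t p \<in> quad_cone"
    unfolding quad_cone_iff z_H_flow_def vector_3 using eq by algebra
qed

lemma flow_maps_Xi: "flow_maps quad_cone Xi = range (\<lambda>t. restrict (shear (\<lambda>_. t)) quad_cone)"
proof (rule flow_maps_eqI)
  show "complete_flow_on quad_cone Xi (\<lambda>t. shear (\<lambda>_. t))"
    unfolding complete_flow_on_iff forall_3 field_components
    by (auto simp: explicit_flows_in_quad_cone)
      (auto simp: shear_def vec_eq_iff forall_3 intro!: derivative_eq_intros)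
next
  fix \<phi> t p assume "complete_flow_on quad_cone Xi \<phi>" and p: "p \<in> quad_cone"
  then have init: "\<phi> 0 p = p"
    and d1: "\<And>t. ((\<lambda>s. \<phi> s p $ 1) has_field_derivative 0) (at t)"
    and d2: "\<And>t. ((\<lambda>s. \<phi> s p $ 2) has_field_derivative 2 * \<phi> t p $ 3) (at t)"
    and d3: "\<And>t. ((\<lambda>s. \<phi> s p $ 3) has_field_derivative \<phi> t p $ 1) (at t)"
    by (simp_all add: complete_flow_on_iff forall_3 field_components)
  have x: "\<phi> s p $ 1 = p $ 1" for s
    by (rule same_derivative_imp_eq[OF d1]) (auto simp: init)
  have z: "\<phi> s p $ 3 = p $ 3 + s * p $ 1" for s
    by (rule same_derivative_imp_eq[OF d3]) (auto simp: init x intro!: derivative_eq_intros)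
  have y: "\<phi> s p $ 2 = p $ 2 + 2 * s * p $ 3 + s\<^sup>2 * p $ 1" for s
    by (rule same_derivative_imp_eq[OF d2])
      (auto simp: init z algebra_simps intro!: derivative_eq_intros)
  show "\<phi> t p = shear (\<lambda>_. t) p"
    by (simp add: vec_eq_iff forall_3 shear_def x y z)
qed

lemma flow_maps_Theta: "flow_maps quad_cone Theta = range (\<lambda>t. restrict (Theta_flow t) quad_cone)"
proof (rule flow_maps_eqI)
  show "complete_flow_on quad_cone Theta Theta_flow"
    unfolding complete_flow_on_iff forall_3 field_components
    by (auto simp: explicit_flows_in_quad_cone)
      (auto simp: Theta_flow_def vec_eq_iff forall_3 intro!: derivative_eq_intros)
next
  fix \<phi> t p assume "complete_flow_on quad_cone Theta \<phi>" and p: "p \<in> quad_cone"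
  then have init: "\<phi> 0 p = p"
    and d1: "\<And>t. ((\<lambda>s. \<phi> s p $ 1) has_field_derivative 2 * \<phi> t p $ 3) (at t)"
    and d2: "\<And>t. ((\<lambda>s. \<phi> s p $ 2) has_field_derivative 0) (at t)"
    and d3: "\<And>t. ((\<lambda>s. \<phi> s p $ 3) has_field_derivative \<phi> t p $ 2) (at t)"
    by (simp_all add: complete_flow_on_iff forall_3 field_components)
  have y: "\<phi> s p $ 2 = p $ 2" for s
    by (rule same_derivative_imp_eq[OF d2]) (auto simp: init)
  have z: "\<phi> s p $ 3 = p $ 3 + s * p $ 2" for s
    by (rule same_derivative_imp_eq[OF d3]) (auto simp: init y intro!: derivative_eq_intros)
  have x: "\<phi> s p $ 1 = p $ 1 + 2 * s * p $ 3 + s\<^sup>2 * p $ 2" for s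
    by (rule same_derivative_imp_eq[OF d1])
      (auto simp: init z algebra_simps intro!: derivative_eq_intros)
  show "\<phi> t p = Theta_flow t p"
    by (simp add: vec_eq_iff forall_3 Theta_flow_def x y z)
qed

text \<open>On the cone the equation \<open>y' = 2 z\<^sup>2\<close> of \<open>z \<Xi>\<close> reads \<open>y' = 2 x y\<close>, which is linear because
  \<open>x\<close> is constant along the flow.\<close>

lemma flow_maps_z_Xi:
  "flow_maps quad_cone (z_times Xi) = range (\<lambda>t. restrict (z_Xi_flow t) quad_cone)"
proof (rule flow_maps_eqI)
  have "((\<lambda>s. z_Xi_flow s p $ 2) has_field_derivative z_Xi_flow t p $ 3 * (2 * z_Xi_flow t p $ 3)) (at t)"
    if p: "p \<in> quad_cone" for t p
  proof -
    have "z_Xi_flow t p $ 3 * (2 * z_Xi_flow t p $ 3) = 2 * z_Xi_flow t p $ 1 * z_Xi_flow t p $ 2"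
      using explicit_flows_in_quad_cone(3)[OF p, of t] by (simp add: quad_cone_iff power2_eq_square)
    then show ?thesis
      by (auto simp: z_Xi_flow_def intro!: derivative_eq_intros)
  qed
  then show "complete_flow_on quad_cone (z_times Xi) z_Xi_flow"
    unfolding complete_flow_on_iff forall_3 field_components
    by (auto simp: explicit_flows_in_quad_cone)
      (auto simp: z_Xi_flow_def vec_eq_iff forall_3 intro!: derivative_eq_intros)
next
  fix \<phi> t p assume \<phi>: "complete_flow_on quad_cone (z_times Xi) \<phi>" and p: "p \<in> quad_cone"
  then have init: "\<phi> 0 p = p"
    and cone: "\<And>t. \<phi> t p \<in> quad_cone"
    and d1: "\<And>t. ((\<lambda>s. \<phi> s p $ 1) has_field_derivative 0) (at t)"
    and d2: "\<And>t. ((\<lambda>s. \<phi> s p $ 2) has_field_derivative \<phi> t p $ 3 * (2 * \<phi> t p $ 3)) (at t)"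
    and d3: "\<And>t. ((\<lambda>s. \<phi> s p $ 3) has_field_derivative \<phi> t p $ 3 * \<phi> t p $ 1) (at t)"
    by (simp_all add: complete_flow_on_iff forall_3 field_components)
  have x: "\<phi> s p $ 1 = p $ 1" for s
    by (rule same_derivative_imp_eq[OF d1]) (auto simp: init)
  have z: "\<phi> s p $ 3 = p $ 3 * exp (p $ 1 * s)" for s
    using derivative_multiple_imp_exp[of "\<lambda>s. \<phi> s p $ 3" "p $ 1" s] d3
    by (simp add: init x mult.commute)
  have zz: "\<phi> s p $ 3 * (2 * \<phi> s p $ 3) = 2 * p $ 1 * \<phi> s p $ 2" for s
    using cone[of s] by (simp add: quad_cone_iff x power2_eq_square)
  have y: "\<phi> s p $ 2 = p $ 2 * exp (2 * p $ 1 * s)" for s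
    using derivative_multiple_imp_exp[OF d2[unfolded zz], of s] by (simp add: init)
  show "\<phi> t p = z_Xi_flow t p"
    by (simp add: vec_eq_iff forall_3 z_Xi_flow_def x y z mult_ac)
qed

lemma flow_maps_z_H:
  "flow_maps quad_cone (z_times Hfield) = range (\<lambda>t. restrict (z_H_flow t) quad_cone)"
proof (rule flow_maps_eqI)
  show "complete_flow_on quad_cone (z_times Hfield) z_H_flow"
    unfolding complete_flow_on_iff forall_3 field_components
    by (auto simp: explicit_flows_in_quad_cone)
      (auto simp: z_H_flow_def vec_eq_iff forall_3 intro!: derivative_eq_intros)
next
  fix \<phi> t p assume "complete_flow_on quad_cone (z_times Hfield) \<phi>" and p: "p \<in> quad_cone"
  then have init: "\<phi> 0 p = p"
    and d1: "\<And>t. ((\<lambda>s. \<phi> s p $ 1) has_field_derivative \<phi> t p $ 3 * - (2 * \<phi> t p $ 1)) (at t)"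
    and d2: "\<And>t. ((\<lambda>s. \<phi> s p $ 2) has_field_derivative \<phi> t p $ 3 * (2 * \<phi> t p $ 2)) (at t)"
    and d3: "\<And>t. ((\<lambda>s. \<phi> s p $ 3) has_field_derivative 0) (at t)"
    by (simp_all add: complete_flow_on_iff forall_3 field_components)
  have z: "\<phi> s p $ 3 = p $ 3" for s
    by (rule same_derivative_imp_eq[OF d3]) (auto simp: init)
  have x: "\<phi> s p $ 1 = p $ 1 * exp (- (2 * p $ 3) * s)" for s
    using derivative_multiple_imp_exp[of "\<lambda>s. \<phi> s p $ 1" "- (2 * p $ 3)" s] d1
    by (simp add: init z mult_ac)
  have y: "\<phi> s p $ 2 = p $ 2 * exp (2 * p $ 3 * s)" for s
    using derivative_multiple_imp_exp[of "\<lambda>s. \<phi> s p $ 2" "2 * p $ 3" s] d2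
    by (simp add: init z mult_ac)
  show "\<phi> t p = z_H_flow t p"
    by (simp add: vec_eq_iff forall_3 z_H_flow_def x y z mult_ac)
qed


lemma explicit_flows_hol_aut:
  "restrict (shear (\<lambda>_. t)) quad_cone \<in> carrier (hol_aut_group quad_cone)"
  "restrict (Theta_flow t) quad_cone \<in> carrier (hol_aut_group quad_cone)"
  "restrict (z_Xi_flow t) quad_cone \<in> carrier (hol_aut_group quad_cone)"
  "restrict (z_H_flow t) quad_cone \<in> carrier (hol_aut_group quad_cone)"
proof -
  have hol: "holomorphic_map_on quad_cone g"
    if "entire_fun (\<lambda>p. g p $ 1)" "entire_fun (\<lambda>p. g p $ 2)" "entire_fun (\<lambda>p. g p $ 3)"
    for g :: "complex ^ 3 \<Rightarrow> complex ^ 3"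
    by (rule holomorphic_map_on_components) (metis exhaust_3 that)
  show "restrict (shear (\<lambda>_. t)) quad_cone \<in> carrier (hol_aut_group quad_cone)"
    by (rule one_parameter_hol_aut[where \<Psi> = "\<lambda>t. shear (\<lambda>_. t)"], rule explicit_flows_in_quad_cone)
      (auto simp: shear_def vec_eq_iff forall_3 algebra_simps power2_eq_square
        intro!: hol entire_fun_intros)
  show "restrict (Theta_flow t) quad_cone \<in> carrier (hol_aut_group quad_cone)"
    by (rule one_parameter_hol_aut[where \<Psi> = Theta_flow], rule explicit_flows_in_quad_cone)
      (auto simp: Theta_flow_def vec_eq_iff forall_3 algebra_simps power2_eq_square
        intro!: hol entire_fun_intros)
  show "restrict (z_Xi_flow t) quad_cone \<in> carrier (hol_aut_group quad_cone)"
    by (rule one_parameter_hol_aut[where \<Psi> = z_Xi_flow], rule explicit_flows_in_quad_cone)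
      (auto simp: z_Xi_flow_def vec_eq_iff forall_3 mult.assoc simp flip: exp_add
        intro!: hol entire_fun_intros)
  have "entire_fun (\<lambda>p :: complex ^ 3. p $ 1 * exp ((- 2 * t) * p $ 3))" for t
    by (intro entire_fun_intros)
  then have "entire_fun (\<lambda>p. z_H_flow t p $ 1)" for t
    by (simp add: z_H_flow_def)
  then show "restrict (z_H_flow t) quad_cone \<in> carrier (hol_aut_group quad_cone)"
    by (intro one_parameter_hol_aut[where \<Psi> = z_H_flow] explicit_flows_in_quad_cone hol)
      (auto simp: z_H_flow_def vec_eq_iff forall_3 mult.assoc simp flip: exp_add
        intro!: entire_fun_intros)
qed

section \<open>Interpolation by exponential sums\<close>

text \<open>Points are added one at a time: \<open>Q\<close> vanishes at the old points but not at the new one, so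
  a multiple of \<open>Q\<close> corrects the new value.\<close>

lemma polynomial_interpolation:
  fixes c :: "'a::field \<Rightarrow> 'a"
  assumes "finite A"
  shows "\<exists>P. \<forall>a\<in>A. poly P a = c a"
  using assms
proof induction
  case (insert a A)
  then obtain P where P: "\<forall>b\<in>A. poly P b = c b" by blast
  define Q where "Q = (\<Prod>b\<in>A. [:- b, 1:])"
  have Q: "poly Q b = 0" if "b \<in> A" for b
    using that insert.hyps by (auto simp: Q_def poly_prod)
  have "poly Q a \<noteq> 0"
    using insert.hyps by (auto simp: Q_def poly_prod)
  then have "\<forall>b\<in>insert a A. poly (P + smult ((c a - poly P a) / poly Q a) Q) b = c b"
    using P Q by auto
  then show ?case by blast
qed simp

text \<open>Since \<open>exp\<close> is injective on the strip \<open>\<bar>Im w\<bar> \<le> 1\<close>, it suffices to scale the finite set into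
  the unit disc.\<close>

lemma exp_separates_finite_set:
  fixes A :: "complex set"
  assumes "finite A"
  shows "\<exists>t. inj_on (\<lambda>x. exp (t * x)) A"
proof -
  obtain B where B: "B > 0" "\<And>x. x \<in> A \<Longrightarrow> norm x \<le> B"
    using finite_imp_bounded[OF assms] by (auto simp: bounded_pos)
  have small: "\<bar>Im (complex_of_real (1 / B) * x)\<bar> \<le> 1" if "x \<in> A" for x
  proof -
    have "\<bar>Im (complex_of_real (1 / B) * x)\<bar> \<le> norm (complex_of_real (1 / B) * x)"
      by (rule abs_Im_le_cmod)
    also have "\<dots> \<le> 1"
      using B(1) B(2)[OF that] by (simp add: norm_mult norm_divide)
    finally show ?thesis .
  qed
  have "inj_on (\<lambda>x. exp (complex_of_real (1 / B) * x)) A"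
  proof (rule inj_onI)
    fix x y assume xy: "x \<in> A" "y \<in> A"
      "exp (complex_of_real (1 / B) * x) = exp (complex_of_real (1 / B) * y)"
    have "complex_of_real (1 / B) * x = complex_of_real (1 / B) * y"
      by (rule exp_complex_eqI) (use small[OF xy(1)] small[OF xy(2)] pi_gt3 xy(3) in linarith)+
    then show "x = y"
      using B(1) by simp
  qed
  then show ?thesis by blast
qed

section \<open>The group generated by the flows\<close>

abbreviation cone_flow_group :: "(complex ^ 3 \<Rightarrow> complex ^ 3) set" where
  "cone_flow_group \<equiv> flow_generated quad_cone {Xi, Theta, z_times Xi, z_times Hfield}"

lemma subgroup_cone_flow_group: "subgroup cone_flow_group (hol_aut_group quad_cone)"
  unfolding flow_generated_def
  by (rule group.generate_is_subgroup[OF group_hol_aut_group])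
    (auto simp: flow_maps_Xi flow_maps_Theta flow_maps_z_Xi flow_maps_z_H explicit_flows_hol_aut)

lemma cone_flow_group_hol_aut: "f \<in> cone_flow_group \<Longrightarrow> f \<in> carrier (hol_aut_group quad_cone)"
  using subgroup.subset[OF subgroup_cone_flow_group] by blast

lemma explicit_flows_in_cone_flow_group:
  "restrict (shear (\<lambda>_. t)) quad_cone \<in> cone_flow_group"
  "restrict (Theta_flow t) quad_cone \<in> cone_flow_group"
  "restrict (z_Xi_flow t) quad_cone \<in> cone_flow_group"
  unfolding flow_generated_def
  by (rule generate.incl; simp add: flow_maps_Xi flow_maps_Theta flow_maps_z_Xi)+

lemma zero_in_quad_cone: "0 \<in> quad_cone"
  by (simp add: quad_cone_iff)

text \<open>The singular point is a zero of all four vector fields; hence the group acts on the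
  regular locus.\<close>

lemma cone_flow_group_fixes_zero:
  assumes "f \<in> cone_flow_group"
  shows "f 0 = 0"
proof -
  interpret group "hol_aut_group quad_cone" by (rule group_hol_aut_group)
  let ?S = "{f \<in> carrier (hol_aut_group quad_cone). f 0 = 0}"
  have "subgroup ?S (hol_aut_group quad_cone)"
  proof (rule subgroupI)
    show "?S \<noteq> {}"
      using one_closed zero_in_quad_cone by (auto simp: hol_aut_one)
    show "inv\<^bsub>hol_aut_group quad_cone\<^esub> f \<in> ?S" if "f \<in> ?S" for f
      using that hol_aut_inv_apply[of f quad_cone 0] zero_in_quad_cone by auto
    show "f \<otimes>\<^bsub>hol_aut_group quad_cone\<^esub> g \<in> ?S" if "f \<in> ?S" "g \<in> ?S" for f g
      using that m_closed[of f g] zero_in_quad_cone by (auto simp: hol_aut_mult compose_def)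
  qed auto
  moreover have "(\<Union>V\<in>{Xi, Theta, z_times Xi, z_times Hfield}. flow_maps quad_cone V) \<subseteq> ?S"
    by (auto simp: flow_maps_Xi flow_maps_Theta flow_maps_z_Xi flow_maps_z_H
        explicit_flows_hol_aut zero_in_quad_cone)
      (auto simp: explicit_flow_defs vec_eq_iff forall_3)
  ultimately have "cone_flow_group \<subseteq> ?S"
    unfolding flow_generated_def by (intro generate_subgroup_incl)
  with assms show ?thesis by blast
qed

lemma cone_flow_group_compose:
  assumes "restrict f quad_cone \<in> cone_flow_group" "restrict g quad_cone \<in> cone_flow_group"
  shows "restrict (\<lambda>p. f (g p)) quad_cone \<in> cone_flow_group"
proof -
  have "restrict g quad_cone \<in> quad_cone \<rightarrow> quad_cone"
    using assms(2) by (intro Bij_imp_funcset hol_aut_Bij cone_flow_group_hol_aut)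
  then have "compose quad_cone (restrict f quad_cone) (restrict g quad_cone)
      = restrict (\<lambda>p. f (g p)) quad_cone"
    by (auto simp: compose_def Pi_iff fun_eq_iff)
  then show ?thesis
    using subgroup.m_closed[OF subgroup_cone_flow_group assms]
    by (simp add: hol_aut_mult cone_flow_group_hol_aut assms)
qed

section \<open>Shears with interpolated coefficients\<close>

text \<open>Shears fix \<open>x\<close>, so their coefficients add.\<close>

lemma shear_shear: "shear f (shear g p) = shear (\<lambda>x. f x + g x) p"
  by (simp add: shear_def vec_eq_iff forall_3 algebra_simps power2_eq_square)

text \<open>The key computation. On the plane, \<open>v\<close> becomes \<open>e\<^bsup>t x\<^esup> v\<close>, then \<open>e\<^bsup>t x\<^esup> v + s u\<close>, and finally
  \<open>v + s e\<^bsup>- t x\<^esup> u\<close>.\<close>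

lemma z_Xi_flow_conjugates_shear:
  "z_Xi_flow (- t) (shear (\<lambda>_. s) (z_Xi_flow t p)) = shear (\<lambda>x. s * exp (- (t * x))) p"
proof -
  have "exp (- (2 * t * p $ 1)) = (exp (- (t * p $ 1)))\<^sup>2"
    "exp (2 * t * p $ 1) = (exp (t * p $ 1))\<^sup>2"
    by (simp_all add: exp_double[symmetric] mult.assoc)
  moreover have "exp (t * p $ 1) * exp (- (t * p $ 1)) = 1"
    by (simp add: exp_minus)
  ultimately show ?thesis
    unfolding shear_def z_Xi_flow_def vec_eq_iff forall_3 vector_3 mult_minus_left mult_minus_right
    by (intro conjI refl; algebra)
qed

lemma shear_sum_in_cone_flow_group:
  assumes "finite K" "\<And>k. k \<in> K \<Longrightarrow> restrict (shear (f k)) quad_cone \<in> cone_flow_group"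
  shows "restrict (shear (\<lambda>x. \<Sum>k\<in>K. f k x)) quad_cone \<in> cone_flow_group"
  using assms
proof (induction K)
  case empty
  show ?case
    unfolding sum.empty by (rule explicit_flows_in_cone_flow_group(1))
next
  case (insert k K)
  have "shear (\<lambda>x. \<Sum>k\<in>insert k K. f k x) = (\<lambda>p. shear (f k) (shear (\<lambda>x. \<Sum>k\<in>K. f k x) p))"
    using insert.hyps by (simp add: fun_eq_iff shear_shear)
  moreover have "restrict (shear (\<lambda>x. \<Sum>k\<in>K. f k x)) quad_cone \<in> cone_flow_group"
    by (intro insert.IH insert.prems) (rule insertI2)
  ultimately show ?case
    using cone_flow_group_compose[OF insert.prems[OF insertI1]] by presburger
qed

lemma exponential_shear_in_cone_flow_group:
  "restrict (shear (\<lambda>x. s * exp (t * x))) quad_cone \<in> cone_flow_group"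
  using cone_flow_group_compose[OF explicit_flows_in_cone_flow_group(3)[of t]
      cone_flow_group_compose[OF explicit_flows_in_cone_flow_group(1)[of s]
        explicit_flows_in_cone_flow_group(3)[of "- t"]]]
    z_Xi_flow_conjugates_shear[of "- t" s]
  by simp

text \<open>With \<open>t\<close> such that \<open>e\<^bsup>t x\<^esup>\<close> separates the points of \<open>A\<close>, a polynomial in \<open>e\<^bsup>t x\<^esup>\<close> interpolates
  arbitrary values on \<open>A\<close>; it is an exponential sum, since powers of \<open>e\<^bsup>t x\<^esup>\<close> are exponentials.\<close>

lemma interpolating_shear:
  assumes "finite A"
  shows "\<exists>f. restrict (shear f) quad_cone \<in> cone_flow_group \<and> (\<forall>x\<in>A. f x = c x)"
proof -
  obtain t where t: "inj_on (\<lambda>x. exp (t * x)) A"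
    using exp_separates_finite_set[OF assms] by blast
  obtain P where P: "\<forall>a\<in>(\<lambda>x. exp (t * x)) ` A. poly P a = c (the_inv_into A (\<lambda>x. exp (t * x)) a)"
    using polynomial_interpolation[OF finite_imageI[OF assms],
        of "\<lambda>x. exp (t * x)" "\<lambda>a. c (the_inv_into A (\<lambda>x. exp (t * x)) a)"]
    by blast
  define f where "f = (\<lambda>x. \<Sum>k\<le>degree P. coeff P k * exp (of_nat k * t * x))"
  have "f x = c x" if "x \<in> A" for x
  proof -
    have "f x = poly P (exp (t * x))"
      by (simp add: f_def poly_altdef exp_of_nat_mult mult.assoc)
    also have "\<dots> = c x"
      using P that the_inv_into_f_f[OF t that] by simp
    finally show ?thesis .
  qed
  moreover have "restrict (shear f) quad_cone \<in> cone_flow_group"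
    unfolding f_def
    by (intro shear_sum_in_cone_flow_group exponential_shear_in_cone_flow_group) simp
  ultimately show ?thesis by blast
qed

section \<open>Infinite transitivity\<close>

text \<open>A shear changes \<open>z\<close> to \<open>z + f(x) x\<close>. Solving for \<open>f(x)\<close> requires \<open>x \<noteq> 0\<close>, and the points need
  distinct \<open>x\<close> because \<open>f\<close> sees only \<open>x\<close>.\<close>

lemma prescribe_z:
  fixes p :: "nat \<Rightarrow> complex ^ 3"
  assumes inj: "inj_on (\<lambda>j. p j $ 1) {..<m}" and nz: "\<And>j. j < m \<Longrightarrow> p j $ 1 \<noteq> 0"
  shows "\<exists>F. restrict F quad_cone \<in> cone_flow_group \<and>
    (\<forall>j<m. F (p j) $ 1 = p j $ 1 \<and> F (p j) $ 3 = c j)"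
proof -
  let ?i = "the_inv_into {..<m} (\<lambda>j. p j $ 1)"
  obtain f where f: "restrict (shear f) quad_cone \<in> cone_flow_group"
    "\<forall>x\<in>(\<lambda>j. p j $ 1) ` {..<m}. f x = (c (?i x) - p (?i x) $ 3) / x"
    using interpolating_shear[OF finite_imageI[OF finite_lessThan[of m]],
        of "\<lambda>j. p j $ 1" "\<lambda>x. (c (?i x) - p (?i x) $ 3) / x"]
    by blast
  have "shear f (p j) $ 1 = p j $ 1 \<and> shear f (p j) $ 3 = c j" if "j < m" for j
  proof -
    have "f (p j $ 1) = (c j - p j $ 3) / p j $ 1"
      using f(2) that by (simp add: the_inv_into_f_f[OF inj])
    then show ?thesis
      using nz[OF that] by (simp add: shear_def)
  qed
  with f(1) show ?thesis by blast
qed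

text \<open>Along the flow of \<open>\<Theta>\<close> the \<open>x\<close>-coordinate of a point is a quadratic polynomial in \<open>t\<close> whose
  coefficients determine the point. Two distinct points therefore share it for at most
  finitely many \<open>t\<close>, and it vanishes only finitely often for a point other than the origin.\<close>

lemma generic_Theta_flow:
  fixes p :: "nat \<Rightarrow> complex ^ 3"
  assumes inj: "inj_on p {..<m}" and nz: "\<And>j. j < m \<Longrightarrow> p j \<noteq> 0"
  shows "\<exists>t. inj_on (\<lambda>j. Theta_flow t (p j) $ 1) {..<m} \<and> (\<forall>j<m. Theta_flow t (p j) $ 1 \<noteq> 0)"
proof -
  define P where "P = (\<lambda>q :: complex ^ 3. [:q $ 1, 2 * q $ 3, q $ 2:])"
  have P: "Theta_flow t q $ 1 = poly (P q) t" for t q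
    by (simp add: P_def Theta_flow_def algebra_simps power2_eq_square)
  have P_inj: "P q = P r \<longleftrightarrow> q = r" for q r
    by (auto simp: P_def vec_eq_iff forall_3)
  have P_0: "P q = 0 \<longleftrightarrow> q = 0" for q
    by (auto simp: P_def vec_eq_iff forall_3)
  define bad where "bad = (\<Union>i\<in>{..<m}. \<Union>j\<in>{..<m} - {i}. {t. poly (P (p i) - P (p j)) t = 0})
    \<union> (\<Union>j\<in>{..<m}. {t. poly (P (p j)) t = 0})"
  have "finite bad"
    unfolding bad_def
    by (intro finite_UnI finite_UN_I finite_Diff finite_lessThan poly_roots_finite)
      (use inj nz in \<open>auto simp: P_inj P_0 inj_on_def\<close>)
  then obtain t where t: "t \<notin> bad"
    using ex_new_if_finite[OF infinite_UNIV_char_0] by blast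
  have "inj_on (\<lambda>j. Theta_flow t (p j) $ 1) {..<m}"
    using t by (fastforce simp: inj_on_def bad_def P)
  moreover have "\<forall>j<m. Theta_flow t (p j) $ 1 \<noteq> 0"
    using t by (auto simp: bad_def P)
  ultimately show ?thesis by blast
qed

text \<open>This is \<open>(u, v) \<mapsto> (v, - u)\<close>, the usual product of three elementary matrices.\<close>

lemma coordinate_swap_in_cone_flow_group:
  "restrict (\<lambda>p. vector [p $ 2, p $ 1, - p $ 3]) quad_cone \<in> cone_flow_group"
proof -
  have "Theta_flow 1 (shear (\<lambda>_. - 1) (Theta_flow 1 p)) = vector [p $ 2, p $ 1, - p $ 3]" for p
    by (simp add: Theta_flow_def shear_def vec_eq_iff forall_3)
  then show ?thesis
    using cone_flow_group_compose[OF explicit_flows_in_cone_flow_group(2)[of 1]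
        cone_flow_group_compose[OF explicit_flows_in_cone_flow_group(1)[of "- 1"]
          explicit_flows_in_cone_flow_group(2)[of 1]]]
    by simp
qed

lemma cone_flow_group_maps:
  assumes "restrict F quad_cone \<in> cone_flow_group" "p \<in> quad_cone"
  shows "F p \<in> quad_cone"
proof -
  have "restrict F quad_cone \<in> quad_cone \<rightarrow> quad_cone"
    using assms(1) by (intro Bij_imp_funcset hol_aut_Bij cone_flow_group_hol_aut)
  from funcset_mem[OF this assms(2)] show ?thesis
    using assms(2) by simp
qed

text \<open>The numbers \<open>j + 1\<close> serve only as pairwise distinct non-zero values. On the cone a point
  with \<open>x \<noteq> 0\<close> is determined by \<open>x\<close> and \<open>z\<close>, so prescribing these two coordinates is enough.\<close>

lemma configuration_normal_form:
  fixes p :: "nat \<Rightarrow> complex ^ 3"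
  assumes reg: "p ` {..<m} \<subseteq> quad_cone_reg" and inj: "inj_on p {..<m}"
  shows "\<exists>F\<in>cone_flow_group. \<forall>j<m. F (p j) = vector [of_nat (Suc j), of_nat (Suc j), of_nat (Suc j)]"
proof -
  have cone: "p j \<in> quad_cone" "p j \<noteq> 0" if "j < m" for j
    using reg that by (auto simp: quad_cone_reg_def)
  obtain t where t: "inj_on (\<lambda>j. Theta_flow t (p j) $ 1) {..<m}"
    "\<And>j. j < m \<Longrightarrow> Theta_flow t (p j) $ 1 \<noteq> 0"
    using generic_Theta_flow[OF inj] cone(2) by blast
  obtain F where F: "restrict F quad_cone \<in> cone_flow_group"
    "\<And>j. j < m \<Longrightarrow> F (Theta_flow t (p j)) $ 1 = Theta_flow t (p j) $ 1"
    "\<And>j. j < m \<Longrightarrow> F (Theta_flow t (p j)) $ 3 = csqrt (Theta_flow t (p j) $ 1 * of_nat (Suc j))"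
    using prescribe_z[OF t, of "\<lambda>j. csqrt (Theta_flow t (p j) $ 1 * of_nat (Suc j))"] by blast
  have y: "F (Theta_flow t (p j)) $ 2 = of_nat (Suc j)" if "j < m" for j
  proof -
    have "F (Theta_flow t (p j)) \<in> quad_cone"
      by (intro cone_flow_group_maps[OF F(1)] explicit_flows_in_quad_cone cone that)
    then show ?thesis
      using t(2)[OF that] F(2,3)[OF that] by (simp add: quad_cone_iff del: of_nat_Suc)
  qed
  \<comment> \<open>The \<open>y\<close>-coordinates are now the standard ones; the swap makes them \<open>x\<close>-coordinates.\<close>
  define H where "H = (\<lambda>q. vector [F (Theta_flow t q) $ 2, F (Theta_flow t q) $ 1,
    - F (Theta_flow t q) $ 3] :: complex ^ 3)"
  have H: "restrict H quad_cone \<in> cone_flow_group"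
    unfolding H_def
    using cone_flow_group_compose[OF coordinate_swap_in_cone_flow_group
        cone_flow_group_compose[OF F(1) explicit_flows_in_cone_flow_group(2)]] by simp
  have Hx: "H (p j) $ 1 = of_nat (Suc j)" if "j < m" for j
    using y[OF that] by (simp add: H_def)
  have "inj_on (\<lambda>j. H (p j) $ 1) {..<m}"
    using Hx by (auto simp: inj_on_def simp del: of_nat_Suc)
  moreover have "H (p j) $ 1 \<noteq> 0" if "j < m" for j
    using Hx[OF that] by (simp del: of_nat_Suc)
  ultimately obtain K where K: "restrict K quad_cone \<in> cone_flow_group"
    "\<And>j. j < m \<Longrightarrow> K (H (p j)) $ 1 = H (p j) $ 1" "\<And>j. j < m \<Longrightarrow> K (H (p j)) $ 3 = of_nat (Suc j)"
    using prescribe_z[of "\<lambda>j. H (p j)" m "\<lambda>j. of_nat (Suc j)"] by blast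
  have "K (H (p j)) = vector [of_nat (Suc j), of_nat (Suc j), of_nat (Suc j)]" if "j < m" for j
  proof -
    have "K (H (p j)) \<in> quad_cone"
      by (intro cone_flow_group_maps[OF K(1)] cone_flow_group_maps[OF H] cone that)
    then have "of_nat (Suc j) * K (H (p j)) $ 2 = of_nat (Suc j) * of_nat (Suc j)"
      unfolding quad_cone_iff K(2)[OF that] K(3)[OF that] Hx[OF that] power2_eq_square .
    then have "K (H (p j)) $ 2 = of_nat (Suc j)"
      by (simp del: of_nat_Suc)
    then show ?thesis
      using K(2,3)[OF that] Hx[OF that] by (simp add: vec_eq_iff forall_3 del: of_nat_Suc)
  qed
  then show ?thesis
    using cone_flow_group_compose[OF K(1) H] cone(1)
    by (intro bexI[of _ "restrict (\<lambda>q. K (H q)) quad_cone"]) simp_all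
qed

text \<open>If \<open>f\<close> and \<open>g\<close> bring the two configurations to the same normal form, then \<open>g\<^sup>-\<^sup>1 f\<close> maps the
  one to the other.\<close>

theorem corollary22:
  fixes G :: "(complex ^ 3 \<Rightarrow> complex ^ 3) set"
  defines "G \<equiv> flow_generated quad_cone {Xi, Theta, z_times Xi, z_times Hfield}"
  shows "subgroup G (hol_aut_group quad_cone) \<and>
         infinitely_transitive_action (hol_aut_group quad_cone \<lparr>carrier := G\<rparr>) quad_cone_reg
           (\<lambda>F. restrict F quad_cone_reg)"
proof
  let ?A = "hol_aut_group quad_cone"
  show sub: "subgroup G ?A"
    unfolding G_def by (rule subgroup_cone_flow_group)
  have act: "group_action (?A\<lparr>carrier := G\<rparr>) quad_cone_reg (\<lambda>F. restrict F quad_cone_reg)"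
    unfolding quad_cone_reg_def
    by (rule group_action_minus_fixed_point[OF sub zero_in_quad_cone])
      (simp add: G_def cone_flow_group_fixes_zero)
  have "\<exists>F\<in>G. \<forall>j<m. restrict F quad_cone_reg (p j) = q j"
    if p: "p ` {..<m} \<subseteq> quad_cone_reg" "inj_on p {..<m}"
      and q: "q ` {..<m} \<subseteq> quad_cone_reg" "inj_on q {..<m}" for m and p q :: "nat \<Rightarrow> complex ^ 3"
  proof -
    obtain f where f: "f \<in> G" "\<And>j. j < m \<Longrightarrow> f (p j) = vector [of_nat (Suc j), of_nat (Suc j), of_nat (Suc j)]"
      using configuration_normal_form[OF p] unfolding G_def by blast
    obtain g where g: "g \<in> G" "\<And>j. j < m \<Longrightarrow> g (q j) = vector [of_nat (Suc j), of_nat (Suc j), of_nat (Suc j)]"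
      using configuration_normal_form[OF q] unfolding G_def by blast
    let ?F = "inv\<^bsub>?A\<^esub> g \<otimes>\<^bsub>?A\<^esub> f"
    have carr: "f \<in> carrier ?A" "g \<in> carrier ?A" "inv\<^bsub>?A\<^esub> g \<in> carrier ?A"
      using f(1) g(1) cone_flow_group_hol_aut group.inv_closed[OF group_hol_aut_group]
      unfolding G_def by blast+
    have "?F \<in> G"
      by (intro subgroup.m_closed[OF sub] subgroup.m_inv_closed[OF sub] f(1) g(1))
    moreover have "restrict ?F quad_cone_reg (p j) = q j" if j: "j < m" for j
    proof -
      have pq: "p j \<in> quad_cone_reg" "p j \<in> quad_cone" "q j \<in> quad_cone"
        using p q j by (auto simp: quad_cone_reg_def)
      have "restrict ?F quad_cone_reg (p j) = (inv\<^bsub>?A\<^esub> g) (f (p j))"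
        using pq carr by (simp add: hol_aut_mult compose_def)
      also have "\<dots> = (inv\<^bsub>?A\<^esub> g) (g (q j))"
        using f(2) g(2) j by simp
      also have "\<dots> = q j"
        by (rule hol_aut_inv_apply[OF carr(2) pq(3)])
      finally show ?thesis .
    qed
    ultimately show ?thesis by blast
  qed
  with act show "infinitely_transitive_action (?A\<lparr>carrier := G\<rparr>) quad_cone_reg
      (\<lambda>F. restrict F quad_cone_reg)"
    by (simp add: infinitely_transitive_action_def m_transitive_on_def)
qed

end
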